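(* Let $\mathcal{S}$ be a finite set of outputs, let $\mathbf{x}$ be an input, let $\hat{\mathbf{y}} \in \mathcal{S}$ be the model's greedy prediction on $\mathbf{x}$, and let $q_{\mathrm{cons.}}(\cdot \mid \mathbf{x})$ and $q_{\mathrm{FES}}(\cdot \mid \mathbf{x})$ be the predictive distributions on $\mathcal{S}$, of the ideally consistent model and of the model $M$ respectively, under functionally equivalent sampling. Then the uncertainty $$U_{\mathrm{FES}}(M \mid \mathbf{x}) = D_{KL}\big(q_{\mathrm{cons.}}(\mathbf{y} \mid \mathbf{x}) \,\|\, q_{\mathrm{FES}}(\mathbf{y} \mid \mathbf{x})\big)$$ simplifies to $$U_{\mathrm{FES}}(M \mid \mathbf{x}) = -\log q_{\mathrm{FES}}(\mathbf{y} = \hat{\mathbf{y}} \mid \mathbf{x}).$$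
   Context: A model $M$ assigns to each input $\mathbf{x}$ in an input space $\mathcal{X}$ a probability distribution $q(\cdot \mid \mathbf{x})$ on a finite output set $\mathcal{S}$; its greedy prediction is $\hat{\mathbf{y}} = \arg\max_{\mathbf{y} \in \mathcal{S}} q(\mathbf{y} \mid \mathbf{x})$. For a fixed input $\mathbf{x}$, let $\mathcal{P}_{\mathrm{FES}}(\cdot \mid \mathbf{x})$ be a probability distribution on inputs (the distribution of "functionally equivalent samples" of $\mathbf{x}$). Write $q(\mathbf{y} \mid \tilde{\mathbf{x}}, \mathbf{x})$ for the predictive distribution $q(\mathbf{y}\mid\tilde{\mathbf{x}})$ of $M$ on a sample $\tilde{\mathbf{x}}$ drawn from $\mathcal{P}_{\mathrm{FES}}(\cdot\mid\mathbf{x})$. The predictive distribution of $M$ under this sampling is $$q_{\mathrm{FES}}(\mathbf{y} \mid \mathbf{x}) = \mathbb{E}_{\tilde{\mathbf{x}} \sim \mathcal{P}_{\mathrm{FES}}(\cdot \mid \mathbf{x})}\, q(\mathbf{y} \mid \tilde{\mathbf{x}}, \mathbf{x}), \quad \mathbf{y} \in \mathcal{S}.$$ The ideally consistent model $M_{\mathrm{cons.}}$ always outputs the original prediction $\hat{\mathbf{y}}$ on such samples: $q_{\mathrm{cons.}}(\mathbf{y} \mid \tilde{\mathbf{x}}, \mathbf{x}) = \delta_{\mathbf{y}\hat{\mathbf{y}}}$ (Kronecker delta) for all such $\tilde{\mathbf{x}}$ and all $\mathbf{y} \in \mathcal{S}$, hence $q_{\mathrm{cons.}}(\mathbf{y}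 \mid \mathbf{x}) = \delta_{\mathbf{y}\hat{\mathbf{y}}}$. The Kullback–Leibler divergence of distributions $p, r$ on a finite set is $D_{KL}(p \| r) = \sum_{\mathbf{y}} p(\mathbf{y}) \log \frac{p(\mathbf{y})}{r(\mathbf{y})}$, with the usual conventions that terms with $p(\mathbf{y})=0$ are $0$ and $-\log 0 = +\infty$. *)

theory Defs
  imports "HOL-Probability.Probability"
begin

text \<open>
  A model is a map \<open>q\<close> from inputs to probability mass functions on outputs, so that
  \<open>pmf (q x) y\<close> is \<open>q(y | x)\<close>. \<open>P\<close> is the distribution of functionally equivalent samples of
  one fixed input, given as a probability measure on the input space.
\<close>

definition q_FES :: "'x measure \<Rightarrow> ('x \<Rightarrow> 'y pmf) \<Rightarrow> 'y \<Rightarrow> real" where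
  "q_FES P q y = (\<integral>x'. pmf (q x') y \<partial>P)"

text \<open>The point mass: \<open>pmf (consistent_model yhat x') y\<close> is the Kronecker delta of \<open>y\<close> and \<open>yhat\<close>.\<close>

definition consistent_model :: "'y \<Rightarrow> 'x \<Rightarrow> 'y pmf" where
  "consistent_model yhat = (\<lambda>x'. return_pmf yhat)"

text \<open>Natural logarithm with values in the extended reals, where \<open>log 0 = -\<infinity>\<close>
  (the values at negative arguments are irrelevant).\<close>

definition eln :: "ereal \<Rightarrow> ereal" where
  "eln u = (if u \<le> 0 then - \<infinity> else if u = \<infinity> then \<infinity> else ereal (ln (real_of_ereal u)))"

text \<open>The divergence \<open>KL_divergence\<close> of \<open>HOL-Probability.Information\<close> is real-valued and so cannot
  be infinite. Here \<open>p y / r y\<close> is division of extended reals, hence \<open>\<infinity>\<close> when \<open>p y > 0\<close> and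
  \<open>r y = 0\<close>.\<close>

definition KL_div :: "'y set \<Rightarrow> ('y \<Rightarrow> real) \<Rightarrow> ('y \<Rightarrow> real) \<Rightarrow> ereal" where
  "KL_div S p r =
     (\<Sum>y\<in>S. if p y = 0 then 0 else ereal (p y) * eln (ereal (p y) / ereal (r y)))"

text \<open>The greedy prediction \<open>yhat\<close> is an argument because the maximiser need not be unique.\<close>

definition U_FES :: "'y set \<Rightarrow> 'x measure \<Rightarrow> ('x \<Rightarrow> 'y pmf) \<Rightarrow> 'y \<Rightarrow> ereal" where
  "U_FES S P q yhat = KL_div S (q_FES P (consistent_model yhat)) (q_FES P q)"

end

theory Submission
  imports Defs
begin

text \<open>The consistent model gives the same point mass at every sample, so averaging over a
  probability measure returns the Kronecker delta at \<open>yhat\<close>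
  (\<open>q_FES_consistent_model\<close>). In the divergence of a point mass from \<open>r\<close>
  only the term at \<open>yhat\<close> survives, with weight 1, leaving log(1 / r(yhat)) = -log
  r(yhat) (\<open>KL_div_point_mass\<close>).\<close>

lemma q_FES_nonneg: "q_FES P q y \<ge> 0"
  by (simp add: q_FES_def)

lemma q_FES_consistent_model:
  assumes "prob_space P"
  shows "q_FES P (consistent_model yhat) = (\<lambda>y. if y = yhat then 1 else 0)"
proof -
  interpret prob_space P by fact
  show ?thesis
    by (auto simp: q_FES_def consistent_model_def prob_space)
qed

text \<open>The usual rule for the logarithm of a reciprocal, extended to 0 so that the result also
  covers a prediction of probability 0 under sampling.\<close>

lemma eln_inverse:
  assumes "a \<ge> 0"
  shows "eln (1 / ereal a) = - eln (ereal a)"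
proof (cases "a = 0")
  case True
  then show ?thesis
    \<comment> \<open>Here 1 / 0 = \<infinity>, so both sides are \<infinity>.\<close>
    by (simp add: eln_def divide_ereal_def)
next
  case False
  with assms have "a > 0"
    by simp
  then show ?thesis
    by (simp add: eln_def one_ereal_def ln_div)
qed

lemma KL_div_point_mass:
  assumes "finite S" "yhat \<in> S" "r yhat \<ge> 0"
  shows "KL_div S (\<lambda>y. if y = yhat then 1 else 0) r = - eln (ereal (r yhat))"
proof -
  have "KL_div S (\<lambda>y. if y = yhat then 1 else 0) r
      = (\<Sum>y\<in>S. if y = yhat then eln (1 / ereal (r y)) else 0)"
    \<comment> \<open>Folding \<open>ereal 1\<close> into \<open>1\<close> lets the weight at
      \<open>yhat\<close> drop out as the unit of multiplication.\<close>
    unfolding KL_div_def by (intro sum.cong) (auto simp flip: one_ereal_def)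
  also have "\<dots> = eln (1 / ereal (r yhat))"
    using assms by simp
  finally show ?thesis
    using assms by (simp add: eln_inverse)
qed

theorem proposition3p1:
  fixes S :: "'y set" and X :: "'x measure" and M :: "'x \<Rightarrow> 'y pmf"
    and P_FES :: "'x \<Rightarrow> 'x measure" and x :: 'x and yhat :: 'y
  assumes "finite S"
    and "\<And>x'. x' \<in> space X \<Longrightarrow> set_pmf (M x') \<subseteq> S"
    and "\<And>y. y \<in> S \<Longrightarrow> (\<lambda>x'. pmf (M x') y) \<in> borel_measurable X"
    and "x \<in> space X"
    and "prob_space (P_FES x)" and "sets (P_FES x) = sets X"
    and "is_arg_max (pmf (M x)) (\<lambda>y. y \<in> S) yhat"
  shows "U_FES S (P_FES x) M yhat = - eln (ereal (q_FES (P_FES x) M yhat))"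
proof -
  \<comment> \<open>Membership ensures that the surviving term occurs in the sum over
    \<open>S\<close>.\<close>
  have "yhat \<in> S"
    using assms(7) by (simp add: is_arg_max_def)
  then show ?thesis
    using assms(1,5)
    by (simp add: U_FES_def q_FES_consistent_model KL_div_point_mass q_FES_nonneg)
qed

end
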